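(* Let $X$ be a separable, locally uniformly convex complex Banach space and let $A$ be the closed linear span of the constant function $1$ and $X^*$, regarded as a subspace of $C_b(B_X)$. Suppose that $H$ is a Banach space (closed linear subspace of $C_b(B_X,X)$ with the sup norm) of uniformly continuous functions from $B_X$ into $X$ which contains the functions $f\otimes y$ for all $f\in A$ and all $y\in X$. Then the numerical Shilov boundary for $H$ exists.
   Context: $B_X$ and $S_X$ are the closed unit ball and unit sphere of $X$. $C_b(B_X)$ and $C_b(B_X,X)$ are the Banach spaces of bounded continuous functions from $B_X$ (norm topology) into $\mathbb{C}$ and $X$, with the sup norm. $(f\otimes y)(x)=f(x)y$. $X$ is locally uniformly convex if whenever $x\in S_X$ and $\{x_n\}\subset B_X$ satisfy $\lim_n\|x_n+x\|=2$, then $\lim_n\|x_n-x\|=0$. $\Pi_X=\{(x,x^* )\in S_X\times S_{X^*}: x^*(x)=1\}$, with the topology $\tau$ induced from $B_X\times B_{X^*}$, where $B_X$ carries the norm topology and $B_{X^*}$ the weak-$*$ topology. The numerical radius of $f\in C_b(B_X,X)$ is $v(f)=\sup\{|x^*(f(x))|:(x,x^* )\in\Pi_X\}$. $B\subset\Pi_X$ is a numerical boundary for $H$ if $v(f)=\sup_{(x,x^* )\in B}|x^*(f(x))|$ for all $f\in H$. The numerical Shilov boundary for $H$ is the smallest ($\tau$-)closed numerical boundary for $H$, if it exists. *)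

theory Defs
  imports "HOL-Analysis.Analysis"
begin

section \<open>Complex normed spaces\<close>

text \<open>
  The real structure of a complex normed space is the one obtained by restricting scalars, so the
  metric and topological library material on real normed spaces applies unchanged.
\<close>

class complex_normed_vector = real_normed_vector +
  fixes scaleC :: "complex \<Rightarrow> 'a \<Rightarrow> 'a" (infixr \<open>*\<^sub>C\<close> 75)
  assumes scaleC_add_right: "a *\<^sub>C (x + y) = a *\<^sub>C x + a *\<^sub>C y"
    and scaleC_add_left: "(a + b) *\<^sub>C x = a *\<^sub>C x + b *\<^sub>C x"
    and scaleC_scaleC: "a *\<^sub>C b *\<^sub>C x = (a * b) *\<^sub>C x"
    and scaleR_scaleC: "r *\<^sub>R x = complex_of_real r *\<^sub>C x"
    and norm_scaleC: "norm (a *\<^sub>C x) = cmod a * norm x"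

lemma scaleC_one: "1 *\<^sub>C x = x" for x :: "'a::complex_normed_vector"
  using scaleR_scaleC[of 1 x] by simp

class complex_banach = complex_normed_vector + complete_space

global_interpretation complex_vector: vector_space "scaleC :: complex \<Rightarrow> 'a \<Rightarrow> 'a::complex_normed_vector"
  defines csubspace = complex_vector.subspace
    and cspan = complex_vector.span
  by unfold_locales (simp_all add: scaleC_add_right scaleC_add_left scaleC_scaleC scaleC_one)

lemma bounded_linear_scaleC_right: "bounded_linear (\<lambda>x::'a::complex_normed_vector. c *\<^sub>C x)"
proof (rule bounded_linear_intro[where K = "cmod c"])
  show "c *\<^sub>C (r *\<^sub>R x) = r *\<^sub>R (c *\<^sub>C x)" for r and x :: 'a
    by (simp add: scaleR_scaleC scaleC_scaleC mult.commute)
qed (simp_all add: scaleC_add_right norm_scaleC mult.commute)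

lemma bounded_linear_scaleC_left: "bounded_linear (\<lambda>c. c *\<^sub>C (y::'a::complex_normed_vector))"
proof (rule bounded_linear_intro[where K = "norm y"])
  show "(r *\<^sub>R c) *\<^sub>C y = r *\<^sub>R (c *\<^sub>C y)" for r c
    by (simp add: scaleR_scaleC scaleC_scaleC scaleR_conv_of_real)
qed (simp_all add: scaleC_add_left norm_scaleC)

instantiation complex :: complex_normed_vector
begin

definition scaleC_complex :: "complex \<Rightarrow> complex \<Rightarrow> complex"
  where "scaleC_complex a z = a * z"

instance
  by standard (simp_all add: scaleC_complex_def algebra_simps norm_mult scaleR_conv_of_real)

end

lemma bcontfun_bounded_linear_image:
  assumes "bounded_linear h"
  shows "(\<lambda>x. h (apply_bcontfun f x)) \<in> bcontfun"
proof -
  have "continuous_on UNIV (\<lambda>x. h (apply_bcontfun f x))"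
    by (intro bounded_linear.continuous_on[OF assms] continuous_on_apply_bcontfun)
  moreover have "bounded (range (\<lambda>x. h (apply_bcontfun f x)))"
    using bounded_linear_image[OF bounded_apply_bcontfun[of f] assms] by (simp add: image_image)
  ultimately show ?thesis
    by (simp add: bcontfun_def)
qed

instantiation bcontfun :: (topological_space, complex_normed_vector) complex_normed_vector
begin

definition scaleC_bcontfun :: "complex \<Rightarrow> ('a \<Rightarrow>\<^sub>C 'b) \<Rightarrow> 'a \<Rightarrow>\<^sub>C 'b"
  where "c *\<^sub>C f = Bcontfun (\<lambda>x. c *\<^sub>C apply_bcontfun f x)"

lemma scaleC_bcontfun_apply [simp]: "apply_bcontfun (c *\<^sub>C f) x = c *\<^sub>C apply_bcontfun f x"
  for f :: "'a \<Rightarrow>\<^sub>C 'b"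
  unfolding scaleC_bcontfun_def
  by (simp add: Bcontfun_inverse bcontfun_bounded_linear_image bounded_linear_scaleC_right)

instance
proof
  fix a b :: complex and r :: real and f g :: "'a \<Rightarrow>\<^sub>C 'b"
  show "a *\<^sub>C (f + g) = a *\<^sub>C f + a *\<^sub>C g"
    by (rule bcontfun_eqI) (simp add: scaleC_add_right)
  show "(a + b) *\<^sub>C f = a *\<^sub>C f + b *\<^sub>C f"
    by (rule bcontfun_eqI) (simp add: scaleC_add_left)
  show "a *\<^sub>C b *\<^sub>C f = (a * b) *\<^sub>C f"
    by (rule bcontfun_eqI) (simp add: scaleC_scaleC)
  show "r *\<^sub>R f = complex_of_real r *\<^sub>C f"
    by (rule bcontfun_eqI) (simp add: scaleR_scaleC)
  have le: "norm (c *\<^sub>C h) \<le> cmod c * norm h" for c and h :: "'a \<Rightarrow>\<^sub>C 'b"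
    by (rule norm_bound) (simp add: norm_scaleC mult_left_mono norm_bounded)
  show "norm (a *\<^sub>C f) = cmod a * norm f"
  proof (cases "a = 0")
    case True
    then show ?thesis
      using le[of 0 f] by simp
  next
    case False
    have "inverse a *\<^sub>C a *\<^sub>C f = f"
      by (rule bcontfun_eqI) (simp add: scaleC_scaleC scaleC_one False)
    then have "norm f \<le> cmod (inverse a) * norm (a *\<^sub>C f)"
      using le[of "inverse a" "a *\<^sub>C f"] by simp
    then have "cmod a * norm f \<le> norm (a *\<^sub>C f)"
      using False by (simp add: norm_divide field_simps)
    then show ?thesis
      using le[of a f] by simp
  qed
qed

end

definition locally_uniformly_convex :: "'a::real_normed_vector itself \<Rightarrow> bool"
  where "locally_uniformly_convex (_ :: 'a itself) \<longleftrightarrow>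
    (\<forall>(x::'a) xs. norm x = 1 \<and> (\<forall>n. norm (xs n) \<le> 1) \<and> (\<lambda>n. norm (xs n + x)) \<longlonglongrightarrow> 2
      \<longrightarrow> (\<lambda>n. norm (xs n - x)) \<longlonglongrightarrow> 0)"

section \<open>The closed unit ball and the dual space\<close>

text \<open>
  The closed unit ball is made a type of its own, with the norm metric, so that
  \<open>'a unit_ball \<Rightarrow>\<^sub>C 'b\<close> is the space of bounded continuous functions on the ball, normed by the
  supremum over the ball.
\<close>

typedef (overloaded) 'a unit_ball = "cball 0 1 :: 'a::real_normed_vector set"
  morphisms ball_vec to_ball
  by (rule exI[of _ 0]) simp

instantiation unit_ball :: (real_normed_vector) metric_space
begin

definition dist_unit_ball :: "'a unit_ball \<Rightarrow> 'a unit_ball \<Rightarrow> real"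
  where "dist_unit_ball x y = dist (ball_vec x) (ball_vec y)"

definition uniformity_unit_ball :: "('a unit_ball \<times> 'a unit_ball) filter"
  where "uniformity_unit_ball = (INF e\<in>{0 <..}. principal {(x, y). dist x y < e})"

definition open_unit_ball :: "'a unit_ball set \<Rightarrow> bool"
  where "open_unit_ball S = (\<forall>x\<in>S. \<forall>\<^sub>F (x', y) in uniformity. x' = x \<longrightarrow> y \<in> S)"

instance
proof
  fix x y z :: "'a unit_ball"
  show "dist x y = 0 \<longleftrightarrow> x = y"
    by (simp add: dist_unit_ball_def ball_vec_inject)
  show "dist x y \<le> dist x z + dist y z"
    unfolding dist_unit_ball_def by (rule dist_triangle2)
qed (rule open_unit_ball_def uniformity_unit_ball_def)+

end

text \<open>
  The type \<open>'a \<Rightarrow>\<^sub>L complex\<close> consists of the bounded real-linear functionals; the dual is the set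
  of complex-linear ones. Its norm is the usual dual norm.
\<close>

definition cdual :: "('a::complex_normed_vector \<Rightarrow>\<^sub>L complex) set"
  where "cdual = {\<phi>. \<forall>c x. blinfun_apply \<phi> (c *\<^sub>C x) = c * blinfun_apply \<phi> x}"

definition restrict_ball :: "('a::real_normed_vector \<Rightarrow>\<^sub>L complex) \<Rightarrow> 'a unit_ball \<Rightarrow>\<^sub>C complex"
  where "restrict_ball \<phi> = Bcontfun (\<lambda>x. blinfun_apply \<phi> (ball_vec x))"

definition tensor :: "('b::topological_space \<Rightarrow>\<^sub>C complex) \<Rightarrow> 'a::complex_normed_vector \<Rightarrow> 'b \<Rightarrow>\<^sub>C 'a"
    (infixl \<open>\<otimes>\<^sub>C\<close> 75)
  where "f \<otimes>\<^sub>C y = Bcontfun (\<lambda>x. apply_bcontfun f x *\<^sub>C y)"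

text \<open>The functions under \<open>Bcontfun\<close> above are indeed bounded and continuous:\<close>

lemma norm_ball_vec: "norm (ball_vec x) \<le> 1"
  using ball_vec[of x] by simp

lemma continuous_on_ball_vec: "continuous_on S ball_vec"
  by (auto simp: continuous_on_iff dist_unit_ball_def)

lemma restrict_ball_apply [simp]:
  "apply_bcontfun (restrict_ball \<phi>) x = blinfun_apply \<phi> (ball_vec x)"
proof -
  have "norm (blinfun_apply \<phi> (ball_vec x)) \<le> norm \<phi>" for x
    using norm_blinfun[of \<phi> "ball_vec x"] mult_left_le[OF norm_ball_vec[of x], of "norm \<phi>"]
    by simp
  then have "(\<lambda>x. blinfun_apply \<phi> (ball_vec x)) \<in> bcontfun"
    by (intro bcontfun_normI[where b = "norm \<phi>"] continuous_intros continuous_on_ball_vec)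
  then show ?thesis
    by (simp add: restrict_ball_def Bcontfun_inverse)
qed

lemma tensor_apply [simp]: "apply_bcontfun (f \<otimes>\<^sub>C y) x = apply_bcontfun f x *\<^sub>C y"
  using bcontfun_bounded_linear_image[OF bounded_linear_scaleC_left[of y], of f]
  by (simp add: tensor_def Bcontfun_inverse)

definition affine_functions :: "('a::complex_normed_vector unit_ball \<Rightarrow>\<^sub>C complex) set"
  where "affine_functions = closure (cspan (insert (const_bcontfun 1) (restrict_ball ` cdual)))"

section \<open>Numerical radius and numerical boundaries\<close>

definition Pi_X :: "('a::complex_normed_vector unit_ball \<times> ('a \<Rightarrow>\<^sub>L complex)) set"
  where "Pi_X = {(x, \<phi>). norm (ball_vec x) = 1 \<and> \<phi> \<in> cdual \<and> norm \<phi> = 1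
    \<and> blinfun_apply \<phi> (ball_vec x) = 1}"

text \<open>
  The strong operator topology on \<open>'a \<Rightarrow>\<^sub>L complex\<close> is the topology of pointwise convergence, so
  it induces the weak-* topology on the dual.
\<close>

definition tau :: "('a::complex_normed_vector unit_ball \<times> ('a \<Rightarrow>\<^sub>L complex)) topology"
  where "tau = subtopology (prod_topology euclidean strong_operator_topology) Pi_X"

text \<open>
  The set of values below is bounded by \<open>norm f\<close> when \<open>B \<subseteq> Pi_X\<close>. For empty \<open>B\<close> its supremum is an
  unspecified real that does not depend on \<open>f\<close>, so the empty set is a numerical boundary only for
  spaces on which the numerical radius is constant.
\<close>

definition numerical_sup ::
    "('a::complex_normed_vector unit_ball \<times> ('a \<Rightarrow>\<^sub>L complex)) set \<Rightarrow> ('a unit_ball \<Rightarrow>\<^sub>C 'a) \<Rightarrow> real"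
  where "numerical_sup B f = (SUP (x, \<phi>)\<in>B. cmod (blinfun_apply \<phi> (apply_bcontfun f x)))"

definition numerical_radius :: "('a::complex_normed_vector unit_ball \<Rightarrow>\<^sub>C 'a) \<Rightarrow> real"
  where "numerical_radius f = numerical_sup Pi_X f"

definition numerical_boundary ::
    "('a::complex_normed_vector unit_ball \<Rightarrow>\<^sub>C 'a) set \<Rightarrow> ('a unit_ball \<times> ('a \<Rightarrow>\<^sub>L complex)) set \<Rightarrow> bool"
  where "numerical_boundary H B \<longleftrightarrow>
    B \<subseteq> Pi_X \<and> (\<forall>f\<in>H. numerical_radius f = numerical_sup B f)"

definition numerical_Shilov_boundary ::
    "('a::complex_normed_vector unit_ball \<Rightarrow>\<^sub>C 'a) set \<Rightarrow> ('a unit_ball \<times> ('a \<Rightarrow>\<^sub>L complex)) set \<Rightarrow> bool"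
  where "numerical_Shilov_boundary H B \<longleftrightarrow>
    closedin tau B \<and> numerical_boundary H B \<and>
    (\<forall>C. closedin tau C \<and> numerical_boundary H C \<longrightarrow> B \<subseteq> C)"

end

theory Submission
  imports Defs
begin

text \<open>
  By Mazur's theorem the smooth points of \<open>X\<close> are dense, and the Shilov boundary is the closure
  of the set of pairs \<open>(x, x*)\<close> in \<open>\<Pi>\<^sub>X\<close> with \<open>x\<close> smooth. This set is a numerical boundary: for
  \<open>(x, x*)\<close> in \<open>\<Pi>\<^sub>X\<close>, a small \<open>t > 0\<close> and a unimodular \<open>c\<close> with \<open>c x*(f x) = |x*(f x)|\<close>, we have
  \<open>\<parallel>x + t c f x\<parallel> \<ge> 1 + t |x*(f x)|\<close>, so that a functional supporting the ball at a smooth point very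
  close to the direction of \<open>x + t c f x\<close> has real part at least about \<open>|x*(f x)|\<close> at \<open>c f x\<close>.
  It is contained in every closed numerical boundary: if \<open>x\<close> is smooth, then by local uniform
  convexity \<open>(1 + x*)/2 \<otimes> x\<close> is almost maximal only at pairs \<open>(z, z*)\<close> with \<open>z\<close> close to \<open>x\<close>, and
  smoothness of \<open>x\<close> forces \<open>z*\<close> to be weak-* close to \<open>x*\<close>.
\<close>

section \<open>Smooth points of the norm\<close>

text \<open>This is Gateaux differentiability of the norm at \<open>x\<close>. By convexity the
  second difference divided by \<open>t\<close> is nondecreasing in \<open>t\<close>, so one value
  below each \<open>e\<close> already means that its limit at 0 vanishes.\<close>

definition smooth_point :: "'a::real_normed_vector \<Rightarrow> bool"
  where "smooth_point x \<longleftrightarrow>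
    (\<forall>h. \<forall>e>0. \<exists>t>0. norm (x + t *\<^sub>R h) + norm (x - t *\<^sub>R h) - 2 * norm x < e * t)"

lemma smooth_pointD:
  assumes "smooth_point x" "e > 0"
  obtains t where "t > 0" "norm (x + t *\<^sub>R h) + norm (x - t *\<^sub>R h) - 2 * norm x < e * t"
  using assms by (auto simp: smooth_point_def)

lemma smooth_point_scaleR:
  assumes "smooth_point x" "r > 0"
  shows "smooth_point (r *\<^sub>R x)"
  unfolding smooth_point_def
proof (intro allI impI)
  fix h and e :: real
  assume "e > 0"
  then obtain t where t: "t > 0" "norm (x + t *\<^sub>R h) + norm (x - t *\<^sub>R h) - 2 * norm x < e * t"
    using smooth_pointD assms(1) by metis
  have 1: "norm (r *\<^sub>R x + (r * t) *\<^sub>R h) = r * norm (x + t *\<^sub>R h)"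
    using \<open>r > 0\<close> norm_scaleR[of r "x + t *\<^sub>R h"] by (simp add: scaleR_add_right)
  have 2: "norm (r *\<^sub>R x - (r * t) *\<^sub>R h) = r * norm (x - t *\<^sub>R h)"
    using \<open>r > 0\<close> norm_scaleR[of r "x - t *\<^sub>R h"] by (simp add: scaleR_diff_right)
  have "r * (norm (x + t *\<^sub>R h) + norm (x - t *\<^sub>R h) - 2 * norm x) < r * (e * t)"
    using t \<open>r > 0\<close> by simp
  then have "norm (r *\<^sub>R x + (r * t) *\<^sub>R h) + norm (r *\<^sub>R x - (r * t) *\<^sub>R h) - 2 * norm (r *\<^sub>R x)
      < e * (r * t)"
    unfolding 1 2 using \<open>r > 0\<close> by (simp add: algebra_simps)
  then show "\<exists>s>0. norm (r *\<^sub>R x + s *\<^sub>R h) + norm (r *\<^sub>R x - s *\<^sub>R h) - 2 * norm (r *\<^sub>R x) < e * s"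
    using t \<open>r > 0\<close> by (intro exI[of _ "r * t"]) simp
qed

section \<open>Density of the smooth points by Baire category\<close>

definition almost_smooth :: "'a::real_normed_vector \<Rightarrow> real \<Rightarrow> 'a set"
  where "almost_smooth h e =
    {x. \<exists>t>0. norm (x + t *\<^sub>R h) + norm (x - t *\<^sub>R h) - 2 * norm x < e * t}"

text \<open>For fixed \<open>t\<close> the condition is a strict inequality between continuous
  functions of \<open>x\<close>. The Baire argument needs this openness.\<close>

lemma open_almost_smooth: "open (almost_smooth h e)"
proof -
  have "almost_smooth h e =
      (\<Union>t\<in>{0<..}. {x. norm (x + t *\<^sub>R h) + norm (x - t *\<^sub>R h) - 2 * norm x < e * t})"
    by (auto simp: almost_smooth_def)
  also have "open \<dots>"
    by (intro open_UN ballI open_Collect_less continuous_intros)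
  finally show ?thesis .
qed

text \<open>
  If the second differences of \<open>s \<mapsto> \<parallel>x + s h\<parallel>\<close> with step \<open>d\<close> were all at least \<open>e d\<close>, then summing
  \<open>N\<close> of them would give \<open>N e d \<le> 2 d \<parallel>h\<parallel>\<close>, which fails for large \<open>N\<close>.
\<close>
lemma closure_almost_smooth:
  assumes "e > 0"
  shows "closure (almost_smooth h e) = UNIV"
proof (intro equalityI subset_UNIV subsetI)
  fix x
  show "x \<in> closure (almost_smooth h e)"
    unfolding closure_approachable
  proof (intro allI impI)
    fix r :: real
    assume "r > 0"
    obtain N :: nat where N: "real N > 2 * norm h / e"
      using reals_Archimedean2 by blast
    \<comment> \<open>With this choice \<open>N + 1\<close> steps of length \<open>d\<close> along
      \<open>h\<close> stay within \<open>r\<close> of \<open>x\<close>. Using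
      \<open>norm h + 1\<close> covers \<open>h = 0\<close> and makes the bound strict.\<close>
    define d where "d = r / ((real N + 1) * (norm h + 1))"
    have pos: "(real N + 1) * (norm h + 1) > 0"
      by (intro mult_pos_pos) (auto intro: add_nonneg_pos)
    have "d > 0"
      using \<open>r > 0\<close> pos by (simp add: d_def)
    define p where "p k = norm (x + (real k * d) *\<^sub>R h)" for k
    have p_Lipschitz: "\<bar>p (Suc k) - p k\<bar> \<le> d * norm h" for k
    proof -
      have "\<bar>p (Suc k) - p k\<bar> \<le> norm ((x + (real (Suc k) * d) *\<^sub>R h) - (x + (real k * d) *\<^sub>R h))"
        unfolding p_def by (rule norm_triangle_ineq3)
      also have "(x + (real (Suc k) * d) *\<^sub>R h) - (x + (real k * d) *\<^sub>R h) = d *\<^sub>R h"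
        by (simp add: algebra_simps)
      finally show ?thesis
        using \<open>d > 0\<close> by simp
    qed
    have "\<exists>k<N. p (Suc (Suc k)) + p k - 2 * p (Suc k) < e * d"
    proof (rule ccontr)
      assume "\<not> ?thesis"
      then have "e * d \<le> (p (Suc (Suc k)) - p (Suc k)) - (p (Suc k) - p k)" if "k < N" for k
        using that by (smt (verit))
      then have "(\<Sum>k<N. e * d) \<le> (\<Sum>k<N. (p (Suc (Suc k)) - p (Suc k)) - (p (Suc k) - p k))"
        by (intro sum_mono) simp
      also have "\<dots> = (p (Suc N) - p N) - (p (Suc 0) - p 0)"
        by (rule sum_lessThan_telescope)
      also have "\<dots> \<le> 2 * (d * norm h)"
        using p_Lipschitz[of N] p_Lipschitz[of 0] by linarith
      finally have "d * (real N * e) \<le> d * (2 * norm h)"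
        by (simp add: mult_ac)
      then have "real N * e \<le> 2 * norm h"
        using \<open>d > 0\<close> by simp
      then show False
        using N \<open>e > 0\<close> by (simp add: field_simps)
    qed
    then obtain k where k: "k < N" "p (Suc (Suc k)) + p k - 2 * p (Suc k) < e * d"
      by blast
    define y where "y = x + (real (Suc k) * d) *\<^sub>R h"
    have y: "y + d *\<^sub>R h = x + (real (Suc (Suc k)) * d) *\<^sub>R h" "y - d *\<^sub>R h = x + (real k * d) *\<^sub>R h"
      by (simp_all add: y_def algebra_simps flip: scaleR_add_left)
    have "norm (y + d *\<^sub>R h) + norm (y - d *\<^sub>R h) - 2 * norm y < e * d"
      unfolding y using k(2) by (simp add: p_def y_def)
    then have "y \<in> almost_smooth h e"
      using \<open>d > 0\<close> by (auto simp: almost_smooth_def)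
    moreover have "dist y x < r"
    proof -
      have "dist y x = real (Suc k) * d * norm h"
        using \<open>d > 0\<close> by (simp add: y_def dist_norm)
      also have "\<dots> \<le> (real N + 1) * d * norm h"
        using k(1) \<open>d > 0\<close> by (intro mult_right_mono) auto
      also have "\<dots> < (real N + 1) * d * (norm h + 1)"
        using \<open>d > 0\<close> by (intro mult_strict_left_mono mult_pos_pos) auto
      also have "\<dots> = r"
        using pos by (auto simp: d_def)
      finally show ?thesis .
    qed
    ultimately show "\<exists>y\<in>almost_smooth h e. dist y x < r"
      by blast
  qed
qed

text \<open>Replacing \<open>h\<close> by \<open>k\<close> changes the second difference by at most
  \<open>2 * t * norm (h - k)\<close>, so dense directions and the tolerances
  \<open>1 / (n + 1)\<close> suffice. For countable \<open>D\<close> these are countably many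
  conditions.\<close>

lemma smooth_point_if_dense:
  assumes "closure D = UNIV" and "\<And>h n. h \<in> D \<Longrightarrow> x \<in> almost_smooth h (inverse (real (Suc n)))"
  shows "smooth_point x"
  unfolding smooth_point_def
proof (intro allI impI)
  fix h and e :: real
  assume "e > 0"
  then obtain n where n: "inverse (real (Suc n)) < e / 2"
    using reals_Archimedean[of "e / 2"] by auto
  have "h \<in> closure D"
    using assms(1) by simp
  \<comment> \<open>Each of the two shifted norms costs \<open>e * t / 4\<close>; the tolerance
    takes the remaining \<open>e * t / 2\<close>.\<close>
  then obtain k where k: "k \<in> D" "dist k h < e / 4"
    unfolding closure_approachable using \<open>e > 0\<close> by (metis divide_pos_pos zero_less_numeral)
  obtain t where t: "t > 0"
    "norm (x + t *\<^sub>R k) + norm (x - t *\<^sub>R k) - 2 * norm x < inverse (real (Suc n)) * t"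
    using assms(2)[OF k(1)] by (auto simp: almost_smooth_def)
  have *: "norm (t *\<^sub>R h - t *\<^sub>R k) \<le> e / 4 * t"
    using k(2) \<open>t > 0\<close> by (simp add: dist_norm norm_minus_commute mult.commute flip: scaleR_diff_right)
  have "norm (x + t *\<^sub>R h) \<le> norm (x + t *\<^sub>R k) + norm (t *\<^sub>R h - t *\<^sub>R k)"
    using norm_triangle_ineq[of "x + t *\<^sub>R k" "t *\<^sub>R h - t *\<^sub>R k"] by simp
  moreover have "norm (x - t *\<^sub>R h) \<le> norm (x - t *\<^sub>R k) + norm (t *\<^sub>R h - t *\<^sub>R k)"
    using norm_triangle_ineq4[of "x - t *\<^sub>R k" "t *\<^sub>R h - t *\<^sub>R k"] by simp
  moreover have "inverse (real (Suc n)) * t \<le> e / 2 * t"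
    using n \<open>t > 0\<close> by (intro mult_right_mono) auto
  ultimately have "norm (x + t *\<^sub>R h) + norm (x - t *\<^sub>R h) - 2 * norm x < e * t"
    using t(2) * by simp
  then show "\<exists>t>0. norm (x + t *\<^sub>R h) + norm (x - t *\<^sub>R h) - 2 * norm x < e * t"
    using \<open>t > 0\<close> by blast
qed

text \<open>The conditions for directions in a countable dense set define countably many open dense
  sets, and every point of their intersection is smooth.\<close>

theorem Mazur_smooth_points_dense:
  assumes "separable_space (euclidean :: 'a::{real_normed_vector, complete_space} topology)"
  shows "closure {x::'a. smooth_point x} = UNIV"
proof -
  obtain D :: "'a set" where D: "countable D" "closure D = UNIV"
    using assms by (auto simp: separable_space_def)
  define G where "G = (\<lambda>(h, n). almost_smooth h (inverse (real (Suc n)))) ` (D \<times> UNIV)"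
  have "euclidean closure_of (\<Inter>G) = topspace (euclidean :: 'a topology)"
  proof (rule Baire_category)
    show "countable G"
      using D(1) by (auto simp: G_def)
    show "openin euclidean T \<and> euclidean closure_of T = topspace euclidean" if "T \<in> G" for T
      using that by (auto simp: G_def open_almost_smooth closure_almost_smooth)
  qed (use completely_metrizable_space_euclidean in blast)
  then have "closure (\<Inter>G) = UNIV"
    by simp
  moreover have "\<Inter>G \<subseteq> {x. smooth_point x}"
    using D(2) by (auto simp: G_def intro!: smooth_point_if_dense)
  ultimately show ?thesis
    using closure_mono by blast
qed

section \<open>Support functionals\<close>

text \<open>The right derivative of the norm at \<open>x\<close> in direction \<open>h\<close>: the
  difference quotients are nondecreasing in \<open>t\<close>, so their infimum is the limit at
  0.\<close>

definition norm_deriv :: "'a::real_normed_vector \<Rightarrow> 'a \<Rightarrow> real"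
  where "norm_deriv x h = (INF t\<in>{0<..}. (norm (x + t *\<^sub>R h) - norm x) / t)"

lemma norm_quotient_ge:
  assumes "t > (0::real)"
  shows "- norm h \<le> (norm (x + t *\<^sub>R h) - norm x) / t"
proof -
  have "norm x - norm (t *\<^sub>R h) \<le> norm (x + t *\<^sub>R h)"
    by (rule norm_diff_ineq)
  then show ?thesis
    using assms by (simp add: field_simps)
qed

lemma norm_deriv_le:
  assumes "t > 0"
  shows "norm_deriv x h \<le> (norm (x + t *\<^sub>R h) - norm x) / t"
  unfolding norm_deriv_def
proof (rule cINF_lower)
  show "bdd_below ((\<lambda>t. (norm (x + t *\<^sub>R h) - norm x) / t) ` {0<..})"
    by (rule bdd_belowI2[of _ "- norm h"]) (simp add: norm_quotient_ge)
qed (use assms in simp)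

lemma norm_deriv_greatest:
  assumes "\<And>t. t > 0 \<Longrightarrow> m \<le> (norm (x + t *\<^sub>R h) - norm x) / t"
  shows "m \<le> norm_deriv x h"
  unfolding norm_deriv_def by (rule cINF_greatest) (use assms in auto)

lemma norm_deriv_le_norm: "norm_deriv x h \<le> norm h"
  using norm_deriv_le[of 1 x h] norm_triangle_ineq[of x h] by simp

text \<open>The point \<open>x + s h\<close> is a convex combination of \<open>x\<close> and
  \<open>x + t h\<close>, so convexity of the norm applies.\<close>

lemma norm_quotient_mono:
  assumes "0 < s" "s \<le> (t::real)"
  shows "(norm (x + s *\<^sub>R h) - norm x) / s \<le> (norm (x + t *\<^sub>R h) - norm x) / t"
proof -
  have "x + s *\<^sub>R h = (1 - s / t) *\<^sub>R x + (s / t) *\<^sub>R (x + t *\<^sub>R h)"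
    using assms by (simp add: algebra_simps)
  then have "norm (x + s *\<^sub>R h) \<le> norm ((1 - s / t) *\<^sub>R x) + norm ((s / t) *\<^sub>R (x + t *\<^sub>R h))"
    by (metis norm_triangle_ineq)
  also have "\<dots> = (1 - s / t) * norm x + (s / t) * norm (x + t *\<^sub>R h)"
    using assms by simp
  finally have "norm (x + s *\<^sub>R h) - norm x \<le> s * ((norm (x + t *\<^sub>R h) - norm x) / t)"
    by (simp add: algebra_simps diff_divide_distrib)
  then show ?thesis
    using assms by (simp add: divide_le_eq mult.commute)
qed

text \<open>The point \<open>x + (r / 2) (h + k)\<close> is the midpoint of \<open>x + r h\<close>
  and \<open>x + r k\<close>. The infima on the right range over independent steps \<open>s\<close>
  and \<open>t\<close>; monotonicity lets both shrink to \<open>r = min s t\<close>.\<close>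

lemma norm_deriv_add_le: "norm_deriv x (h + k) \<le> norm_deriv x h + norm_deriv x k"
proof -
  have *: "norm_deriv x (h + k) \<le> (norm (x + s *\<^sub>R h) - norm x) / s + (norm (x + t *\<^sub>R k) - norm x) / t"
    if "s > 0" "t > 0" for s t
  proof -
    define r where "r = min s t"
    have r: "r > 0" "r \<le> s" "r \<le> t"
      using that by (auto simp: r_def)
    have "norm_deriv x (h + k) \<le> (norm (x + (r / 2) *\<^sub>R (h + k)) - norm x) / (r / 2)"
      using r by (intro norm_deriv_le) simp
    also have "x + (r / 2) *\<^sub>R (h + k) = (1 / 2) *\<^sub>R (x + r *\<^sub>R h) + (1 / 2) *\<^sub>R (x + r *\<^sub>R k)"
      by (simp add: scaleR_add_right flip: scaleR_add_left)
    also have "(norm \<dots> - norm x) / (r / 2) \<le>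
        (1 / 2 * norm (x + r *\<^sub>R h) + 1 / 2 * norm (x + r *\<^sub>R k) - norm x) / (r / 2)"
      using r norm_triangle_ineq[of "(1 / 2) *\<^sub>R (x + r *\<^sub>R h)" "(1 / 2) *\<^sub>R (x + r *\<^sub>R k)"]
      by (intro divide_right_mono) auto
    also have "\<dots> = (norm (x + r *\<^sub>R h) - norm x) / r + (norm (x + r *\<^sub>R k) - norm x) / r"
      using r by (simp add: field_simps)
    also have "\<dots> \<le> (norm (x + s *\<^sub>R h) - norm x) / s + (norm (x + t *\<^sub>R k) - norm x) / t"
      using r by (intro add_mono norm_quotient_mono)
    finally show ?thesis .
  qed
  have "norm_deriv x (h + k) - (norm (x + s *\<^sub>R h) - norm x) / s \<le> norm_deriv x k" if "s > 0" for s
    using *[OF that] by (intro norm_deriv_greatest) (simp add: algebra_simps)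
  then have "norm_deriv x (h + k) - norm_deriv x k \<le> norm_deriv x h"
    by (intro norm_deriv_greatest) (simp add: algebra_simps)
  then show ?thesis
    by simp
qed

lemma norm_deriv_scaleR_le:
  assumes "r > 0"
  shows "norm_deriv x (r *\<^sub>R h) \<le> r * norm_deriv x h"
proof -
  have "norm_deriv x (r *\<^sub>R h) / r \<le> norm_deriv x h"
  proof (rule norm_deriv_greatest)
    fix t :: real
    assume "t > 0"
    then show "norm_deriv x (r *\<^sub>R h) / r \<le> (norm (x + t *\<^sub>R h) - norm x) / t"
      using norm_deriv_le[of "t / r" x "r *\<^sub>R h"] assms by (simp add: field_simps)
  qed
  then show ?thesis
    using assms by (simp add: field_simps)
qed

lemma norm_deriv_scaleR_pos:
  assumes "r > 0"
  shows "norm_deriv x (r *\<^sub>R h) = r * norm_deriv x h"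
proof (rule antisym)
  show "r * norm_deriv x h \<le> norm_deriv x (r *\<^sub>R h)"
    using norm_deriv_scaleR_le[of "inverse r" x "r *\<^sub>R h"] assms by (simp add: field_simps)
qed (rule norm_deriv_scaleR_le[OF assms])

lemma norm_deriv_self: "norm_deriv x x = norm x"
proof (rule antisym)
  show "norm x \<le> norm_deriv x x"
  proof (rule norm_deriv_greatest)
    fix t :: real
    assume "t > 0"
    have "x + t *\<^sub>R x = (1 + t) *\<^sub>R x"
      by (simp add: algebra_simps)
    then have "norm (x + t *\<^sub>R x) = (1 + t) * norm x"
      using \<open>t > 0\<close> by simp
    then show "norm x \<le> (norm (x + t *\<^sub>R x) - norm x) / t"
      using \<open>t > 0\<close> by (simp add: field_simps)
  qed
qed (rule norm_deriv_le_norm)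

lemma norm_deriv_zero: "norm_deriv x 0 = 0"
  by (simp add: norm_deriv_def)

section \<open>Linearity of the norm derivative at a smooth point\<close>

context
  fixes x :: "'a::real_normed_vector"
  assumes smooth: "smooth_point x"
begin

text \<open>The derivatives along \<open>h\<close> and \<open>- h\<close> add up to at most a second
  difference divided by \<open>t\<close>, which smoothness makes arbitrarily small; subadditivity
  gives the other inequality. Oddness then turns the sublinear derivative into a linear one.\<close>

lemma norm_deriv_minus: "norm_deriv x (- h) = - norm_deriv x h"
proof -
  have "norm_deriv x h + norm_deriv x (- h) \<le> e" if e: "e > 0" for e
  proof -
    obtain t where t: "t > 0" "norm (x + t *\<^sub>R h) + norm (x - t *\<^sub>R h) - 2 * norm x < e * t"
      using smooth_pointD[OF smooth e, of h] by blast
    have "norm_deriv x h + norm_deriv x (- h)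
        \<le> (norm (x + t *\<^sub>R h) - norm x) / t + (norm (x + t *\<^sub>R (- h)) - norm x) / t"
      using t by (intro add_mono norm_deriv_le)
    also have "\<dots> = (norm (x + t *\<^sub>R h) + norm (x - t *\<^sub>R h) - 2 * norm x) / t"
      by (simp add: add_divide_distrib diff_divide_distrib)
    also have "\<dots> \<le> e"
      using t by (simp add: divide_le_eq)
    finally show ?thesis .
  qed
  then have "norm_deriv x h + norm_deriv x (- h) \<le> 0"
    by (metis field_le_epsilon add_0)
  moreover have "0 \<le> norm_deriv x h + norm_deriv x (- h)"
    using norm_deriv_add_le[of x h "- h"] by (simp add: norm_deriv_zero)
  ultimately show ?thesis
    by simp
qed

lemma norm_deriv_add: "norm_deriv x (h + k) = norm_deriv x h + norm_deriv x k"
  using norm_deriv_add_le[of x h k] norm_deriv_add_le[of x "h + k" "- k"]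
  by (simp add: norm_deriv_minus)

lemma norm_deriv_scaleR: "norm_deriv x (r *\<^sub>R h) = r * norm_deriv x h"
proof (cases r "0::real" rule: linorder_cases)
  case less
  then show ?thesis
    using norm_deriv_scaleR_pos[of "- r" x h] norm_deriv_minus[of "r *\<^sub>R h"] by simp
qed (simp_all add: norm_deriv_zero norm_deriv_scaleR_pos)

end

lemma scaleC_minus_one: "(- 1) *\<^sub>C x = - x" for x :: "'a::complex_normed_vector"
  using scaleR_scaleC[of "- 1" x] by simp

text \<open>No appeal to the Hahn-Banach theorem: the real part is the derivative of the norm.\<close>
lemma smooth_point_support_functional:
  fixes x :: "'a::complex_normed_vector"
  assumes "smooth_point x" "x \<noteq> 0"
  obtains \<phi> where "\<phi> \<in> cdual" "norm \<phi> = 1" "blinfun_apply \<phi> x = of_real (norm x)"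
proof -
  \<comment> \<open>A complex-linear functional with real part \<open>u\<close> must send
    \<open>h\<close> to \<open>u h - i u (i h)\<close>.\<close>
  define F where "F h = Complex (norm_deriv x h) (- norm_deriv x (\<i> *\<^sub>C h))" for h
  note add = norm_deriv_add[OF assms(1)] and scale = norm_deriv_scaleR[OF assms(1)]
    and minus = norm_deriv_minus[OF assms(1)]
  have F_add: "F (h + k) = F h + F k" for h k
    by (simp add: F_def complex_eq_iff add scaleC_add_right)
  have comm: "\<i> *\<^sub>C r *\<^sub>R h = r *\<^sub>R \<i> *\<^sub>C h" for r and h :: 'a
    by (simp add: scaleR_scaleC scaleC_scaleC mult.commute)
  have F_scaleR: "F (r *\<^sub>R h) = of_real r * F h" for r h
    by (simp add: F_def complex_eq_iff scale comm)
  have F_i: "F (\<i> *\<^sub>C h) = \<i> * F h" for h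
    by (simp add: F_def complex_eq_iff scaleC_scaleC scaleC_minus_one minus)
  have F_scaleC: "F (c *\<^sub>C h) = c * F h" for c h
  proof -
    have "c *\<^sub>C h = Re c *\<^sub>R h + \<i> *\<^sub>C (Im c *\<^sub>R h)"
      unfolding scaleR_scaleC scaleC_scaleC scaleC_add_left[symmetric]
      by (simp add: complex_eq_iff)
    then have "F (c *\<^sub>C h) = of_real (Re c) * F h + \<i> * (of_real (Im c) * F h)"
      by (simp add: F_add F_scaleR F_i)
    also have "\<dots> = (of_real (Re c) + \<i> * of_real (Im c)) * F h"
      by (simp add: algebra_simps)
    finally show ?thesis
      by (simp flip: complex_eq)
  qed
  have F_le: "norm (F h) \<le> norm h" for h
  proof (cases "F h = 0")
    case False
    \<comment> \<open>Rotating \<open>F h\<close> onto the positive real axis turns the bound on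
      real parts into a bound on the modulus.\<close>
    define c where "c = of_real (norm (F h)) / F h"
    have c: "norm c = 1" "c * F h = of_real (norm (F h))"
      using False by (simp_all add: c_def norm_divide)
    have "norm (F h) = Re (F (c *\<^sub>C h))"
      by (simp add: F_scaleC c)
    also have "\<dots> \<le> norm (c *\<^sub>C h)"
      by (simp add: F_def norm_deriv_le_norm)
    finally show ?thesis
      by (simp add: norm_scaleC c)
  qed simp
  have bl: "bounded_linear F"
    by (rule bounded_linear_intro[where K = 1])
      (simp_all add: F_add F_scaleR F_le scaleR_conv_of_real)
  define \<phi> where "\<phi> = Blinfun F"
  have \<phi>: "blinfun_apply \<phi> = F"
    using bl by (simp add: \<phi>_def bounded_linear_Blinfun_apply)
  have "Re (F x) = norm x"
    by (simp add: F_def norm_deriv_self)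
  \<comment> \<open>The modulus is at most \<open>norm x\<close> and the real part equals
    \<open>norm x\<close>, so the imaginary part vanishes.\<close>
  then have Fx: "F x = of_real (norm x)"
    using F_le[of x] abs_Re_le_cmod[of "F x"] cmod_power2[of "F x"]
    by (simp add: complex_eq_iff)
  have "norm \<phi> \<le> 1"
    by (rule norm_blinfun_bound) (simp_all add: \<phi> F_le)
  moreover have "norm x \<le> norm \<phi> * norm x"
    using norm_blinfun[of \<phi> x] by (simp add: \<phi> Fx)
  ultimately have "norm \<phi> = 1"
    using \<open>x \<noteq> 0\<close> by simp
  then show ?thesis
    using that[of \<phi>] by (simp add: cdual_def \<phi> F_scaleC Fx)
qed

section \<open>Weak-* convergence of support functionals\<close>

lemma Re_blinfun_le_norm:
  assumes "norm \<phi> \<le> 1"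
  shows "Re (blinfun_apply \<phi> h) \<le> norm h"
proof -
  have "Re (blinfun_apply \<phi> h) \<le> norm \<phi> * norm h"
    using complex_Re_le_cmod norm_blinfun order_trans by blast
  also have "\<dots> \<le> 1 * norm h"
    using assms by (intro mult_right_mono) auto
  finally show ?thesis
    by simp
qed

text \<open>Since \<open>psi n\<close> supports at \<open>z n\<close> and \<open>phi\<close> at
  \<open>x\<close>, \<open>t * Re (psi n h - phi h)\<close> is at most
  \<open>norm (z n + t h) - norm (z n) + norm (x - t h) - norm x\<close>. For fixed \<open>t\<close>
  this tends to the second difference at \<open>x\<close>, which smoothness puts below
  \<open>e * t\<close>.\<close>

lemma smooth_point_support_tendsto:
  fixes x :: "'a::complex_normed_vector" and z :: "nat \<Rightarrow> 'a"
  assumes "smooth_point x" and z: "z \<longlonglongrightarrow> x"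
    and \<phi>: "\<phi> \<in> cdual" "norm \<phi> \<le> 1" "blinfun_apply \<phi> x = of_real (norm x)"
    and \<psi>: "\<And>n. \<psi> n \<in> cdual" "\<And>n. norm (\<psi> n) \<le> 1"
      "\<And>n. blinfun_apply (\<psi> n) (z n) = of_real (norm (z n))"
  shows "(\<lambda>n. blinfun_apply (\<psi> n) h) \<longlonglongrightarrow> blinfun_apply \<phi> h"
proof -
  have upper: "eventually (\<lambda>n. Re (blinfun_apply (\<psi> n) h) < Re (blinfun_apply \<phi> h) + e) sequentially"
    if e: "e > 0" for e h
  proof -
    obtain t where t: "t > 0" "norm (x + t *\<^sub>R h) + norm (x - t *\<^sub>R h) - 2 * norm x < e * t"
      using smooth_pointD[OF assms(1) e, of h] by blast
    have "(\<lambda>n. norm (z n + t *\<^sub>R h) - norm (z n) + norm (x - t *\<^sub>R h) - norm x)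
        \<longlonglongrightarrow> norm (x + t *\<^sub>R h) - norm x + norm (x - t *\<^sub>R h) - norm x"
      by (intro tendsto_intros z)
    then have "eventually (\<lambda>n. norm (z n + t *\<^sub>R h) - norm (z n) + norm (x - t *\<^sub>R h) - norm x
        < e * t) sequentially"
      by (rule order_tendstoD) (use t in simp)
    then show ?thesis
    proof eventually_elim
      case (elim n)
      have "norm (z n) + t * Re (blinfun_apply (\<psi> n) h) \<le> norm (z n + t *\<^sub>R h)"
        using Re_blinfun_le_norm[OF \<psi>(2), of n "z n + t *\<^sub>R h"]
        by (simp add: blinfun.add_right blinfun.scaleR_right \<psi>(3))
      moreover have "norm x - t * Re (blinfun_apply \<phi> h) \<le> norm (x - t *\<^sub>R h)"
        using Re_blinfun_le_norm[OF \<phi>(2), of "x - t *\<^sub>R h"]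
        by (simp add: blinfun.diff_right blinfun.scaleR_right \<phi>(3))
      ultimately have "t * Re (blinfun_apply (\<psi> n) h) < t * (Re (blinfun_apply \<phi> h) + e)"
        using elim by (simp add: algebra_simps)
      then show ?case
        using \<open>t > 0\<close> by simp
    qed
  qed
  have Re: "(\<lambda>n. Re (blinfun_apply (\<psi> n) h)) \<longlonglongrightarrow> Re (blinfun_apply \<phi> h)" for h
  proof (rule order_tendstoI)
    fix a
    assume "Re (blinfun_apply \<phi> h) < a"
    then show "eventually (\<lambda>n. Re (blinfun_apply (\<psi> n) h) < a) sequentially"
      using upper[of "a - Re (blinfun_apply \<phi> h)" h] by simp
  next
    fix a
    assume "a < Re (blinfun_apply \<phi> h)"
    \<comment> \<open>The lower bound is the upper bound in direction \<open>- h\<close>.\<close>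
    then show "eventually (\<lambda>n. a < Re (blinfun_apply (\<psi> n) h)) sequentially"
      using upper[of "Re (blinfun_apply \<phi> h) - a" "- h"] by (simp add: blinfun.minus_right)
  qed
  have Im_eq: "Im (blinfun_apply \<theta> h) = - Re (blinfun_apply \<theta> (\<i> *\<^sub>C h))" if "\<theta> \<in> cdual" for \<theta>
    using that by (simp add: cdual_def)
  have "(\<lambda>n. Im (blinfun_apply (\<psi> n) h)) \<longlonglongrightarrow> Im (blinfun_apply \<phi> h)"
    unfolding Im_eq[OF \<phi>(1)] Im_eq[OF \<psi>(1)] by (intro tendsto_minus Re)
  with Re show ?thesis
    by (simp add: tendsto_complex_iff)
qed

text \<open>The topology is pulled back along \<open>blinfun_apply\<close> from the product
  topology, where convergence is componentwise.\<close>

lemma limitin_strong_operator_topology: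
  assumes "\<And>h. ((\<lambda>n. blinfun_apply (\<psi> n) h) \<longlongrightarrow> blinfun_apply \<phi> h) F"
  shows "limitin strong_operator_topology \<psi> \<phi> F"
  unfolding limitin_def
proof (intro conjI allI impI)
  show "\<phi> \<in> topspace strong_operator_topology"
    by (simp add: strong_operator_topology_topspace)
  fix U
  assume U: "openin strong_operator_topology U \<and> \<phi> \<in> U"
  then obtain V where V: "open V" "U = blinfun_apply -` V"
    by (auto simp: strong_operator_topology_def openin_pullback_topology)
  have "limitin (product_topology (\<lambda>_. euclidean) UNIV) (\<lambda>n. blinfun_apply (\<psi> n)) (blinfun_apply \<phi>) F"
    using assms by (simp add: limitin_componentwise)
  then have "((\<lambda>n. blinfun_apply (\<psi> n)) \<longlongrightarrow> blinfun_apply \<phi>) F"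
    by (simp add: euclidean_product_topology)
  then have "eventually (\<lambda>n. blinfun_apply (\<psi> n) \<in> V) F"
    using V U by (auto simp: tendsto_def)
  then show "eventually (\<lambda>n. \<psi> n \<in> U) F"
    by (simp add: V)
qed

section \<open>The numerical Shilov boundary\<close>

lemma Pi_X_D:
  assumes "(x, \<phi>) \<in> Pi_X"
  shows "norm (ball_vec x) = 1" "\<phi> \<in> cdual" "norm \<phi> = 1" "blinfun_apply \<phi> (ball_vec x) = 1"
  using assms by (auto simp: Pi_X_def)

lemma cmod_blinfun_le:
  assumes "norm \<phi> = 1"
  shows "cmod (blinfun_apply \<phi> h) \<le> norm h"
  using norm_blinfun[of \<phi> h] assms by simp

lemma bdd_above_numerical_values:
  fixes f :: "'a::complex_normed_vector unit_ball \<Rightarrow>\<^sub>C 'a"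
  assumes "B \<subseteq> Pi_X"
  shows "bdd_above ((\<lambda>(x, \<phi>). cmod (blinfun_apply \<phi> (apply_bcontfun f x))) ` B)"
proof (rule bdd_aboveI2)
  fix p
  assume "p \<in> B"
  then obtain x \<phi> where p: "p = (x, \<phi>)" "(x, \<phi>) \<in> Pi_X"
    using assms by (cases p) auto
  then show "(case p of (x, \<phi>) \<Rightarrow> cmod (blinfun_apply \<phi> (apply_bcontfun f x))) \<le> norm f"
    using cmod_blinfun_le Pi_X_D norm_bounded order_trans by fastforce
qed

lemma numerical_sup_upper:
  assumes "(x, \<phi>) \<in> B" "B \<subseteq> Pi_X"
  shows "cmod (blinfun_apply \<phi> (apply_bcontfun f x)) \<le> numerical_sup B f"
  using cSUP_upper[OF assms(1) bdd_above_numerical_values[OF assms(2)]]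
  by (simp add: numerical_sup_def)

lemma numerical_sup_least:
  assumes "B \<noteq> {}" "\<And>x \<phi>. (x, \<phi>) \<in> B \<Longrightarrow> cmod (blinfun_apply \<phi> (apply_bcontfun f x)) \<le> M"
  shows "numerical_sup B f \<le> M"
  unfolding numerical_sup_def using assms by (intro cSUP_least) auto

lemma less_numerical_supD:
  assumes "B \<noteq> {}" "B \<subseteq> Pi_X" "m < numerical_sup B f"
  obtains x \<phi> where "(x, \<phi>) \<in> B" "m < cmod (blinfun_apply \<phi> (apply_bcontfun f x))"
  using assms(3) numerical_sup_least[OF assms(1), of f m] by (meson not_less)

lemma numerical_sup_mono:
  assumes "B \<noteq> {}" "B \<subseteq> C" "C \<subseteq> Pi_X"
  shows "numerical_sup B f \<le> numerical_sup C f"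
  using assms by (intro numerical_sup_least numerical_sup_upper) auto

lemma tendsto_unit_ball:
  assumes "((\<lambda>n. ball_vec (z n)) \<longlongrightarrow> ball_vec x) F"
  shows "(z \<longlongrightarrow> x) F"
  using assms by (simp add: tendsto_dist_iff[of z] tendsto_dist_iff[of "\<lambda>n. ball_vec (z n)"]
      dist_unit_ball_def)

section \<open>Smooth pairs determine the numerical radius\<close>

definition smooth_pairs :: "('a::complex_normed_vector unit_ball \<times> ('a \<Rightarrow>\<^sub>L complex)) set"
  where "smooth_pairs = {(x, \<phi>) \<in> Pi_X. smooth_point (ball_vec x)}"

lemma smooth_pairs_subset: "smooth_pairs \<subseteq> Pi_X"
  by (auto simp: smooth_pairs_def)

text \<open>The perturbation runs along steps \<open>t n\<close> tending to 0, so that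
  \<open>z n\<close> tends to \<open>x\<close> and continuity of \<open>f\<close> lets
  \<open>f (z n)\<close> be replaced by \<open>y\<close> with vanishing error.\<close>

lemma smooth_pairs_numerical_values:
  fixes f :: "'a::complex_banach unit_ball \<Rightarrow>\<^sub>C 'a"
  assumes "separable_space (euclidean :: 'a topology)"
    and x\<phi>: "(x, \<phi>) \<in> Pi_X" and "m < cmod (blinfun_apply \<phi> (apply_bcontfun f x))"
  obtains z \<psi> where "(z, \<psi>) \<in> smooth_pairs" "m < cmod (blinfun_apply \<psi> (apply_bcontfun f z))"
proof -
  define v where "v = ball_vec x"
  define y where "y = apply_bcontfun f x"
  define a where "a = cmod (blinfun_apply \<phi> y)"
  obtain c where c: "cmod c = 1" "c * blinfun_apply \<phi> y = of_real a"
  proof (cases "a = 0")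
    case False
    show ?thesis
      by (rule that[of "of_real a / blinfun_apply \<phi> y"]) (use False in \<open>auto simp: a_def norm_divide\<close>)
  qed (use that[of 1] in \<open>auto simp: a_def\<close>)
  define k where "k = c *\<^sub>C y"
  have \<phi>k: "blinfun_apply \<phi> k = of_real a"
    using Pi_X_D(2)[OF x\<phi>] c by (simp add: k_def cdual_def)
  define t where "t n = inverse (real (Suc n))" for n
  have t: "0 < t n" "t n \<le> 1" for n
    by (auto simp: t_def field_simps)
  have t_lim: "t \<longlonglongrightarrow> 0"
    unfolding t_def by (rule LIMSEQ_inverse_real_of_nat)
  define u where "u n = v + t n *\<^sub>R k" for n
  \<comment> \<open>The error must be of smaller order than \<open>t n\<close>, by which the
    estimate is divided later. It enters twice, in the norm of \<open>w n\<close> and in passing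
    from \<open>w n\<close> to \<open>u n\<close>, for a total loss of \<open>t n\<close> after
    division.\<close>
  have "\<exists>w. smooth_point w \<and> dist w (u n) < (t n)\<^sup>2 / 2" for n
  proof -
    have "u n \<in> closure {x. smooth_point x}"
      using Mazur_smooth_points_dense[OF assms(1)] by simp
    then show ?thesis
      using t[of n] unfolding closure_approachable by (auto dest!: spec[of _ "(t n)\<^sup>2 / 2"])
  qed
  then obtain w where w: "\<And>n. smooth_point (w n)" "\<And>n. dist (w n) (u n) < (t n)\<^sup>2 / 2"
    by metis
  have u_ge: "1 + t n * a \<le> norm (u n)" for n
    using Re_blinfun_le_norm[of \<phi> "u n"] Pi_X_D[OF x\<phi>]
    by (simp add: u_def v_def blinfun.add_right blinfun.scaleR_right \<phi>k)
  have w_ge: "1 + t n * a - (t n)\<^sup>2 / 2 \<le> norm (w n)" for n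
    using u_ge[of n] w(2)[of n] norm_triangle_ineq2[of "u n" "w n"]
    by (simp add: dist_norm norm_minus_commute)
  have w_nz: "w n \<noteq> 0" for n
  proof -
    have "(t n)\<^sup>2 \<le> 1" "0 \<le> t n * a"
      using t[of n] by (auto simp: power_le_one a_def)
    then show ?thesis
      using w_ge[of n] by auto
  qed
  have "\<exists>\<psi>. \<psi> \<in> cdual \<and> norm \<psi> = 1 \<and> blinfun_apply \<psi> (w n) = of_real (norm (w n))" for n
    using smooth_point_support_functional[OF w(1) w_nz] by blast
  then obtain \<psi> where \<psi>: "\<And>n. \<psi> n \<in> cdual" "\<And>n. norm (\<psi> n) = 1"
      "\<And>n. blinfun_apply (\<psi> n) (w n) = of_real (norm (w n))"
    by metis
  define z where "z n = to_ball (w n /\<^sub>R norm (w n))" for n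
  have z: "ball_vec (z n) = w n /\<^sub>R norm (w n)" for n
    unfolding z_def using w_nz[of n] by (intro to_ball_inverse) simp
  have pairs: "(z n, \<psi> n) \<in> smooth_pairs" for n
    using w_nz[of n] by (simp add: smooth_pairs_def Pi_X_def z \<psi> blinfun.scaleR_right
        scaleR_conv_of_real smooth_point_scaleR w(1))
  have "w \<longlonglongrightarrow> v"
  proof -
    have "(\<lambda>n. v + t n *\<^sub>R k) \<longlonglongrightarrow> v + 0 *\<^sub>R k"
      by (intro tendsto_intros t_lim)
    then have "u \<longlonglongrightarrow> v"
      by (simp add: u_def[abs_def])
    moreover have "(\<lambda>n. w n - u n) \<longlonglongrightarrow> 0"
    proof (rule Lim_null_comparison)
      show "eventually (\<lambda>n. norm (w n - u n) \<le> (t n)\<^sup>2 / 2) sequentially"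
        using w(2) by (auto simp: dist_norm intro!: always_eventually less_imp_le)
      show "(\<lambda>n. (t n)\<^sup>2 / 2) \<longlonglongrightarrow> 0"
        using tendsto_divide[OF tendsto_power[OF t_lim, of 2] tendsto_const[of 2]] by simp
    qed
    ultimately show ?thesis
      using tendsto_add by fastforce
  qed
  have "norm v = 1"
    using Pi_X_D(1)[OF x\<phi>] by (simp add: v_def)
  have "(\<lambda>n. w n /\<^sub>R norm (w n)) \<longlonglongrightarrow> v /\<^sub>R norm v"
    by (intro tendsto_intros \<open>w \<longlonglongrightarrow> v\<close>) (use \<open>norm v = 1\<close> in auto)
  then have "z \<longlonglongrightarrow> x"
    by (intro tendsto_unit_ball) (simp add: z \<open>norm v = 1\<close> flip: v_def)
  then have fz: "(\<lambda>n. apply_bcontfun f (z n)) \<longlonglongrightarrow> y"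
    unfolding y_def by (rule continuous_on_tendsto_compose[OF continuous_on_apply_bcontfun[of UNIV]]) auto
  \<comment> \<open>The real part of \<open>psi n\<close> is at least
    \<open>1 + t n * a - (t n)^2\<close> at \<open>u n\<close> and at most 1 at \<open>v\<close>, so
    its value at \<open>k\<close> must account for the gain.\<close>
  have lower: "a - t n - norm (apply_bcontfun f (z n) - y)
      \<le> cmod (blinfun_apply (\<psi> n) (apply_bcontfun f (z n)))" for n
  proof -
    have "norm (w n) - (t n)\<^sup>2 / 2 \<le> Re (blinfun_apply (\<psi> n) (u n))"
      using Re_blinfun_le_norm[of "\<psi> n" "w n - u n"] w(2)[of n]
      by (simp add: \<psi> blinfun.diff_right dist_norm)
    also have "\<dots> = Re (blinfun_apply (\<psi> n) v) + t n * Re (blinfun_apply (\<psi> n) k)"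
      by (simp add: u_def blinfun.add_right blinfun.scaleR_right)
    also have "\<dots> \<le> 1 + t n * Re (blinfun_apply (\<psi> n) k)"
      using Re_blinfun_le_norm[of "\<psi> n" v] \<open>norm v = 1\<close> by (simp add: \<psi>)
    finally have "t n * (a - t n) \<le> t n * Re (blinfun_apply (\<psi> n) k)"
      using w_ge[of n] by (simp add: algebra_simps power2_eq_square)
    then have "a - t n \<le> Re (blinfun_apply (\<psi> n) k)"
      using t(1) by simp
    also have "\<dots> \<le> cmod (blinfun_apply (\<psi> n) k)"
      by (rule complex_Re_le_cmod)
    also have "\<dots> = cmod (blinfun_apply (\<psi> n) y)"
      using \<psi>(1)[of n] by (simp add: k_def cdual_def norm_mult c)
    also have "\<dots> \<le> cmod (blinfun_apply (\<psi> n) (apply_bcontfun f (z n)))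
        + cmod (blinfun_apply (\<psi> n) (apply_bcontfun f (z n) - y))"
      using norm_triangle_sub[of "blinfun_apply (\<psi> n) y" "blinfun_apply (\<psi> n) (apply_bcontfun f (z n))"]
      by (simp add: blinfun.diff_right norm_minus_commute)
    also have "cmod (blinfun_apply (\<psi> n) (apply_bcontfun f (z n) - y))
        \<le> norm (apply_bcontfun f (z n) - y)"
      by (rule cmod_blinfun_le[OF \<psi>(2)])
    finally show ?thesis
      by simp
  qed
  have "(\<lambda>n. a - t n - norm (apply_bcontfun f (z n) - y)) \<longlonglongrightarrow> a - 0 - norm (y - y)"
    by (intro tendsto_intros t_lim fz)
  then have "eventually (\<lambda>n. m < a - t n - norm (apply_bcontfun f (z n) - y)) sequentially"
    by (rule order_tendstoD) (use assms(3) in \<open>simp add: a_def y_def\<close>)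
  then obtain n where "m < a - t n - norm (apply_bcontfun f (z n) - y)"
    by (meson eventually_happens' sequentially_bot)
  then show ?thesis
    using that[OF pairs, of n] lower[of n] by simp
qed

lemma numerical_radius_smooth_pairs:
  fixes f :: "'a::complex_banach unit_ball \<Rightarrow>\<^sub>C 'a"
  assumes sep: "separable_space (euclidean :: 'a topology)"
    and B: "smooth_pairs \<subseteq> B" "B \<subseteq> Pi_X"
  shows "numerical_radius f = numerical_sup B f"
proof (cases "Pi_X = ({} :: ('a unit_ball \<times> ('a \<Rightarrow>\<^sub>L complex)) set)")
  case True
  then show ?thesis
    using B by (simp add: numerical_radius_def)
next
  case False
  have value_le: "cmod (blinfun_apply \<phi> (apply_bcontfun f x)) \<le> numerical_sup B f"
    if x\<phi>: "(x, \<phi>) \<in> Pi_X" for x \<phi>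
  proof (rule ccontr)
    assume "\<not> ?thesis"
    then obtain z \<psi> where "(z, \<psi>) \<in> smooth_pairs"
        "numerical_sup B f < cmod (blinfun_apply \<psi> (apply_bcontfun f z))"
      using smooth_pairs_numerical_values[OF sep x\<phi>] by (metis not_less)
    then show False
      using numerical_sup_upper[of z \<psi> B f] B by auto
  qed
  obtain x \<phi> where x\<phi>: "(x, \<phi>) \<in> (Pi_X :: ('a unit_ball \<times> ('a \<Rightarrow>\<^sub>L complex)) set)"
    using False by auto
  \<comment> \<open>Any strict lower bound of a value produces a smooth pair; subtracting 1 supplies
    one.\<close>
  have "smooth_pairs \<noteq> ({} :: ('a unit_ball \<times> ('a \<Rightarrow>\<^sub>L complex)) set)"
    using smooth_pairs_numerical_values[OF sep x\<phi>, of
        "cmod (blinfun_apply \<phi> (apply_bcontfun f x)) - 1" f] by fastforce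
  then show ?thesis
    unfolding numerical_radius_def using False value_le B
    by (intro antisym numerical_sup_least numerical_sup_mono) auto
qed

section \<open>Closed numerical boundaries contain the smooth pairs\<close>

lemma half_one_plus_functional_affine:
  assumes "\<phi> \<in> cdual"
  shows "(1 / 2) *\<^sub>C (const_bcontfun 1 + restrict_ball \<phi>) \<in> affine_functions"
  unfolding affine_functions_def
  using assms by (intro subsetD[OF closure_subset] complex_vector.span_scale
      complex_vector.span_add complex_vector.span_base) auto

lemma smooth_pairs_subset_closed_boundary:
  fixes H :: "('a::complex_normed_vector unit_ball \<Rightarrow>\<^sub>C 'a) set"
  assumes luc: "locally_uniformly_convex TYPE('a)" and H: "csubspace H"
    and tensor: "\<And>f y. f \<in> affine_functions \<Longrightarrow> f \<otimes>\<^sub>C y \<in> H"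
    and C: "closedin tau C" "numerical_boundary H C"
  shows "smooth_pairs \<subseteq> C"
proof (rule subrelI)
  fix x and \<phi> :: "'a \<Rightarrow>\<^sub>L complex"
  assume "(x, \<phi>) \<in> smooth_pairs"
  then have x\<phi>: "(x, \<phi>) \<in> Pi_X" and smooth: "smooth_point (ball_vec x)"
    by (auto simp: smooth_pairs_def)
  note D = Pi_X_D[OF x\<phi>]
  have CP: "C \<subseteq> Pi_X" and C_radius: "\<And>f. f \<in> H \<Longrightarrow> numerical_radius f = numerical_sup C f"
    using C(2) by (auto simp: numerical_boundary_def)
  \<comment> \<open>A peak function: \<open>psi (g z)\<close> is the product of
    \<open>(1 + phi z) / 2\<close> and \<open>psi x\<close>, both of modulus at most 1, and equals 1
    at the pair \<open>(x, phi)\<close>.\<close>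
  define g where "g = ((1 / 2) *\<^sub>C (const_bcontfun 1 + restrict_ball \<phi>)) \<otimes>\<^sub>C ball_vec x"
  have g_apply: "blinfun_apply \<psi> (apply_bcontfun g z) =
      (1 + blinfun_apply \<phi> (ball_vec z)) / 2 * blinfun_apply \<psi> (ball_vec x)" if "\<psi> \<in> cdual" for \<psi> z
    using that by (simp add: g_def cdual_def scaleC_complex_def)
  have g: "g \<in> H"
    unfolding g_def by (intro tensor half_one_plus_functional_affine D)
  have "1 \<le> numerical_radius g"
    using numerical_sup_upper[OF x\<phi> order_refl, of g] by (simp add: numerical_radius_def g_apply D)
  then have sup_g: "1 \<le> numerical_sup C g"
    using C_radius[OF g] by simp
  \<comment> \<open>A supremum over the empty set is an unspecified real, possibly above 1. It would
    however be the same for \<open>g\<close> and for 0, whose numerical radii differ.\<close>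
  have "C \<noteq> {}"
  proof
    assume "C = {}"
    then have "numerical_sup C g = numerical_sup C 0"
      by (simp add: numerical_sup_def)
    also have "\<dots> = numerical_radius (0 :: 'a unit_ball \<Rightarrow>\<^sub>C 'a)"
      using C_radius[OF complex_vector.subspace_0[OF H]] by simp
    also have "\<dots> \<le> 0"
      unfolding numerical_radius_def by (rule numerical_sup_least) (use x\<phi> in auto)
    finally show False
      using sup_g by simp
  qed
  have "\<exists>z \<psi>. (z, \<psi>) \<in> C \<and> 1 - inverse (real (Suc n)) < cmod (blinfun_apply \<psi> (apply_bcontfun g z))"
    for n
  proof -
    have "1 - inverse (real (Suc n)) < numerical_sup C g"
      using sup_g by (rule less_le_trans[rotated]) simp
    then show ?thesis
      by (rule less_numerical_supD[OF \<open>C \<noteq> {}\<close> CP]) blast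
  qed
  then obtain z \<psi> where z\<psi>: "\<And>n. (z n, \<psi> n) \<in> C"
      "\<And>n. 1 - inverse (real (Suc n)) < cmod (blinfun_apply (\<psi> n) (apply_bcontfun g (z n)))"
    by metis
  have E: "(z n, \<psi> n) \<in> Pi_X" for n
    using z\<psi>(1) CP by blast
  note E' = Pi_X_D[OF E]
  \<comment> \<open>A value of \<open>g\<close> near 1 forces \<open>phi (z n + x)\<close>, hence
    \<open>norm (z n + x)\<close>, to be near 2, as local uniform convexity requires.\<close>
  have lower: "2 - 2 * inverse (real (Suc n)) \<le> norm (ball_vec (z n) + ball_vec x)" for n
  proof -
    have "1 - inverse (real (Suc n)) \<le>
        cmod (1 + blinfun_apply \<phi> (ball_vec (z n))) / 2 * cmod (blinfun_apply (\<psi> n) (ball_vec x))"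
      using z\<psi>(2)[of n] by (simp add: g_apply E' norm_mult norm_divide)
    also have "\<dots> \<le> cmod (1 + blinfun_apply \<phi> (ball_vec (z n))) / 2"
      using cmod_blinfun_le[OF E'(3), of n "ball_vec x"] D(1) by (intro mult_left_le) auto
    also have "1 + blinfun_apply \<phi> (ball_vec (z n)) = blinfun_apply \<phi> (ball_vec (z n) + ball_vec x)"
      by (simp add: blinfun.add_right D)
    finally show ?thesis
      using cmod_blinfun_le[OF D(3), of "ball_vec (z n) + ball_vec x"] by simp
  qed
  have "(\<lambda>n. norm (ball_vec (z n) + ball_vec x)) \<longlonglongrightarrow> 2"
  proof (rule tendsto_sandwich)
    show "eventually (\<lambda>n. 2 - 2 * inverse (real (Suc n)) \<le> norm (ball_vec (z n) + ball_vec x)) sequentially"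
      using lower by simp
    show "eventually (\<lambda>n. norm (ball_vec (z n) + ball_vec x) \<le> 2) sequentially"
      using norm_triangle_ineq[of _ "ball_vec x"] by (metis (no_types, lifting) D(1) E'(1)
          always_eventually one_add_one)
    show "(\<lambda>n. 2 - 2 * inverse (real (Suc n))) \<longlonglongrightarrow> 2"
      using tendsto_diff[OF tendsto_const tendsto_mult[OF tendsto_const LIMSEQ_inverse_real_of_nat],
          of 2 2] by simp
  qed simp
  then have "(\<lambda>n. norm (ball_vec (z n) - ball_vec x)) \<longlonglongrightarrow> 0"
    using luc D(1) norm_ball_vec unfolding locally_uniformly_convex_def by fast
  then have z_lim: "(\<lambda>n. ball_vec (z n)) \<longlonglongrightarrow> ball_vec x"
    by (simp add: tendsto_norm_zero_iff LIM_zero_iff)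
  \<comment> \<open>Local uniform convexity controlled the points; smoothness of \<open>x\<close>
    now controls the functionals, giving convergence in \<open>tau\<close>.\<close>
  have "(\<lambda>n. blinfun_apply (\<psi> n) h) \<longlonglongrightarrow> blinfun_apply \<phi> h" for h
    by (rule smooth_point_support_tendsto[OF smooth z_lim]) (simp_all add: D E')
  then have "limitin tau (\<lambda>n. (z n, \<psi> n)) (x, \<phi>) sequentially"
    unfolding tau_def using x\<phi> E tendsto_unit_ball[OF z_lim]
    by (simp add: limitin_subtopology limitin_pairwise o_def limitin_strong_operator_topology)
  then show "(x, \<phi>) \<in> C"
    by (rule limitin_closedin[OF _ C(1)]) (simp_all add: z\<psi>)
qed

theorem corollary6p4:
  fixes H :: "('a::complex_banach unit_ball \<Rightarrow>\<^sub>C 'a) set"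
  assumes "separable_space (euclidean :: 'a topology)"
    and "locally_uniformly_convex TYPE('a)"
    and "csubspace H" and "closed H"
    and "\<And>f. f \<in> H \<Longrightarrow> uniformly_continuous_on UNIV (apply_bcontfun f)"
    and "\<And>f y. f \<in> affine_functions \<Longrightarrow> f \<otimes>\<^sub>C y \<in> H"
  shows "\<exists>B. numerical_Shilov_boundary H B"
proof -
  have topspace: "topspace tau = (Pi_X :: ('a unit_ball \<times> ('a \<Rightarrow>\<^sub>L complex)) set)"
    by (simp add: tau_def strong_operator_topology_topspace)
  define B :: "('a unit_ball \<times> ('a \<Rightarrow>\<^sub>L complex)) set" where "B = tau closure_of smooth_pairs"
  have B: "smooth_pairs \<subseteq> B" "B \<subseteq> Pi_X"
    unfolding B_def using closure_of_subset closure_of_subset_topspace smooth_pairs_subset topspace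
    by metis+
  have "numerical_boundary H B"
    using B numerical_radius_smooth_pairs[OF assms(1) B] by (simp add: numerical_boundary_def)
  moreover have "B \<subseteq> C" if "closedin tau C" "numerical_boundary H C" for C
    unfolding B_def
    using smooth_pairs_subset_closed_boundary[OF assms(2,3,6) that] that(1) by (rule closure_of_minimal)
  ultimately show ?thesis
    unfolding numerical_Shilov_boundary_def B_def using closedin_closure_of by blast
qed

end
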